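(* Let $n \ge 3$ and let $S$ be a sequence over the cyclic group $C_n$ such that $0$ is not a term of $S$ and $N_0(S) = 2^{|S|-n+1}$. Then $n-1 \le |S| \le n$ and $S = a^{|S|}$ for some element $a$ generating $C_n$.
   Context: A sequence over $G$ is a finite unordered list $S = g_1 \cdots g_m$ of elements of $G$ with repetition allowed; $|S|=m$; $a^k$ denotes the sequence consisting of $k$ copies of $a$. $N_0(S) = |\{I \subseteq [1,m] : \sum_{i\in I} g_i = 0\}|$, the number of subsequences (counted by index sets, the empty one included) with sum $0$. *)

theory Defs
  imports "HOL-Algebra.Algebra" "HOL-Combinatorics.Permutations"
begin

text \<open>
  Groups are multiplicative records, so \<open>\<one>\<^bsub>G\<^esub>\<close> plays the role of \<open>0\<close> and \<open>finprod G\<close> the role of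
  the sum. A sequence over \<open>G\<close> is a multiset; to count index sets, its terms are listed as
  \<open>g ! 0, \<dots>, g ! (m - 1)\<close>. The lemma \<open>N0_mset\<close> below shows that the choice of listing is irrelevant.
\<close>

definition N0 :: "('a, 'b) monoid_scheme \<Rightarrow> 'a multiset \<Rightarrow> nat" where
  "N0 G S = (let g = (SOME xs. mset xs = S) in
     card {I. I \<subseteq> {..<length g} \<and> finprod G (\<lambda>i. g ! i) I = \<one>\<^bsub>G\<^esub>})"

lemma (in comm_monoid) card_index_sets_cong_mset:
  assumes eq: "mset xs = mset ys" and sub: "set ys \<subseteq> carrier G"
  shows "card {I. I \<subseteq> {..<length xs} \<and> finprod G (\<lambda>i. xs ! i) I = \<one>}
       = card {I. I \<subseteq> {..<length ys} \<and> finprod G (\<lambda>i. ys ! i) I = \<one>}"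
proof -
  obtain p where p: "p permutes {..<length ys}" and xs: "permute_list p ys = xs"
    using mset_eq_permutation[OF eq] by blast
  have len: "length xs = length ys"
    using eq by (rule mset_eq_length)
  have inj: "inj p"
    using p by (rule permutes_inj)
  have nth: "xs ! i = ys ! p i" if "i < length ys" for i
    using permute_list_nth[OF p that] xs by simp
  have prod: "finprod G (\<lambda>i. ys ! i) (p ` I) = finprod G (\<lambda>i. xs ! i) I"
    if I: "I \<subseteq> {..<length ys}" for I
  proof -
    have "p ` I \<subseteq> {..<length ys}"
      using I permutes_image[OF p] by blast
    then have mem: "ys ! i \<in> carrier G" if "i \<in> p ` I" for i
      using that sub by (meson lessThan_iff nth_mem subsetD)
    have "finprod G (\<lambda>i. ys ! i) (p ` I) = finprod G (\<lambda>i. ys ! p i) I"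
      by (rule finprod_reindex) (use mem inj in \<open>auto intro: inj_on_subset\<close>)
    also have "\<dots> = finprod G (\<lambda>i. xs ! i) I"
      by (rule finprod_cong') (use I nth mem in \<open>auto simp: Pi_def subset_iff\<close>)
    finally show ?thesis .
  qed
  have "bij_betw ((`) p) {I. I \<subseteq> {..<length xs} \<and> finprod G (\<lambda>i. xs ! i) I = \<one>}
          {I. I \<subseteq> {..<length ys} \<and> finprod G (\<lambda>i. ys ! i) I = \<one>}"
    unfolding bij_betw_def
  proof (intro conjI equalityI subsetI)
    show "inj_on ((`) p) {I. I \<subseteq> {..<length xs} \<and> finprod G (\<lambda>i. xs ! i) I = \<one>}"
      using inj by (simp add: inj_on_def inj_image_eq_iff)
  next
    fix J assume "J \<in> (`) p ` {I. I \<subseteq> {..<length xs} \<and> finprod G (\<lambda>i. xs ! i) I = \<one>}"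
    then obtain I where I: "J = p ` I" "I \<subseteq> {..<length ys}" "finprod G (\<lambda>i. xs ! i) I = \<one>"
      using len by auto
    moreover have "p ` I \<subseteq> {..<length ys}"
      using I permutes_image[OF p] by blast
    ultimately show "J \<in> {I. I \<subseteq> {..<length ys} \<and> finprod G (\<lambda>i. ys ! i) I = \<one>}"
      using prod by simp
  next
    fix J assume "J \<in> {I. I \<subseteq> {..<length ys} \<and> finprod G (\<lambda>i. ys ! i) I = \<one>}"
    then have J: "J \<subseteq> p ` {..<length ys}" "finprod G (\<lambda>i. ys ! i) J = \<one>"
      using permutes_image[OF p] by auto
    then obtain I where "I \<subseteq> {..<length ys}" "J = p ` I"
      by (meson subset_imageE)
    then show "J \<in> (`) p ` {I. I \<subseteq> {..<length xs} \<and> finprod G (\<lambda>i. xs ! i) I = \<one>}"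
      using J prod len by auto
  qed
  then show ?thesis
    by (rule bij_betw_same_card)
qed

lemma (in comm_monoid) N0_mset:
  assumes "set xs \<subseteq> carrier G"
  shows "N0 G (mset xs) = card {I. I \<subseteq> {..<length xs} \<and> finprod G (\<lambda>i. xs ! i) I = \<one>}"
proof -
  have "mset (SOME ys. mset ys = mset xs) = mset xs"
    by (rule someI) (rule refl)
  from card_index_sets_cong_mset[OF this assms] show ?thesis
    by (simp add: N0_def Let_def)
qed

end

theory Submission
  imports Defs
begin

text \<open>
  If \<open>N\<^sub>x\<close> counts the subsequences with product \<open>x\<close> and some subsequence \<open>T\<close> has product \<open>x\<close>, then
  inverting the terms of \<open>T\<close> and replacing \<open>I\<close> by its symmetric difference with \<open>T\<close> turns \<open>N\<^sub>x\<close>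
  into \<open>N\<^sub>1\<close> of another sequence of the same length. Splitting off a term \<open>g\<close> of a nonempty
  subsequence with product \<open>1\<close> therefore doubles the lower bound for \<open>N\<^sub>1\<close>, whence Olson's bound
  \<open>N\<^sub>1(S) \<ge> 2^(|S|-n+1)\<close>. If equality holds for \<open>S\<close>, it also holds after removing any such \<open>g\<close>;
  as \<open>1\<close> is not a term, there are two choices for \<open>g\<close>, and by induction both remaining sequences
  are constant, so \<open>S\<close> is. The induction starts at sequences of length \<open>n - 1\<close> without nonempty
  subsequence of product \<open>1\<close>: two distinct terms would produce four subsequence products, and each
  further term at least one more, which exceeds \<open>n\<close>. Lengths above \<open>n\<close> are excluded by counting the
  subsequences of \<open>a^(n+1)\<close>.
\<close>

context comm_group
begin

section \<open>Counting subsequences with a given product\<close>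

text \<open>Sequences are families \<open>f\<close> on an index set \<open>A\<close> rather than
  lists: dropping a term only shrinks \<open>A\<close>, and inverting terms only changes
  \<open>f\<close>.\<close>

definition num_prods :: "('i \<Rightarrow> 'a) \<Rightarrow> 'i set \<Rightarrow> 'a \<Rightarrow> nat" where
  "num_prods f A x = card {I. I \<subseteq> A \<and> finprod G f I = x}"

text \<open>These are the zero-sum free sequences, in multiplicative notation.\<close>

definition product_one_free :: "('i \<Rightarrow> 'a) \<Rightarrow> 'i set \<Rightarrow> bool" where
  "product_one_free f A \<longleftrightarrow> (\<forall>T. T \<subseteq> A \<longrightarrow> finprod G f T = \<one> \<longrightarrow> T = {})"

lemma num_prods_one_pos:
  assumes "finite A"
  shows "num_prods f A \<one> > 0"
proof -
  have "{} \<in> {I. I \<subseteq> A \<and> finprod G f I = \<one>}" by simp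
  moreover have "finite {I. I \<subseteq> A \<and> finprod G f I = \<one>}"
    using assms by simp
  ultimately show ?thesis
    unfolding num_prods_def by (metis card_gt_0_iff empty_iff)
qed

lemma product_one_free_if_num_prods_eq_1:
  assumes "num_prods f A \<one> = 1"
  shows "product_one_free f A"
proof -
  obtain U where U: "{I. I \<subseteq> A \<and> finprod G f I = \<one>} = {U}"
    using assms unfolding num_prods_def by (rule card_1_singletonE)
  have "T = U" if "T \<subseteq> A" "finprod G f T = \<one>" for T
  proof -
    have "T \<in> {I. I \<subseteq> A \<and> finprod G f I = \<one>}" using that by simp
    then show ?thesis unfolding U by simp
  qed
  from this this[of "{}"] show ?thesis
    unfolding product_one_free_def by simp
qed

section \<open>Products of subsequences of a product-one free sequence\<close>

lemma finprod_subset_split: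
  assumes "finite A" "f \<in> A \<rightarrow> carrier G" "J \<subseteq> A"
  shows "finprod G f A = finprod G f J \<otimes> finprod G f (A - J)"
proof -
  have "finprod G f (J \<union> (A - J)) = finprod G f J \<otimes> finprod G f (A - J)"
    by (rule finprod_Un_disjoint) (use assms in \<open>auto intro: finite_subset\<close>)
  then show ?thesis using assms by (simp add: Un_absorb1)
qed

text \<open>If the products agreed, cancelling the product over \<open>J\<close> would leave
  \<open>I - J\<close> as a nonempty subsequence with product one.\<close>

lemma finprod_psubset_neq:
  assumes "finite A" "f \<in> A \<rightarrow> carrier G" "product_one_free f A" "J \<subset> I" "I \<subseteq> A"
  shows "finprod G f J \<noteq> finprod G f I"
proof
  assume eq: "finprod G f J = finprod G f I"
  have fin: "finite I" using assms finite_subset by blast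
  have "finprod G f I = finprod G f J \<otimes> finprod G f (I - J)"
    by (rule finprod_subset_split) (use assms fin in auto)
  moreover have "finprod G f J \<in> carrier G" "finprod G f (I - J) \<in> carrier G"
    using assms by (auto intro!: finprod_closed)
  ultimately have "finprod G f (I - J) = \<one>"
    using eq by (metis l_cancel_one)
  then have "I - J = {}"
    using assms unfolding product_one_free_def by (metis Diff_subset order_trans)
  then show False using assms(4) by auto
qed

text \<open>Each new index yields at least one new value: the product over all indices taken so far,
  the new one included, differs from the product over every proper subset.\<close>

lemma card_subproducts_add:
  assumes "finite A" "f \<in> A \<rightarrow> carrier G" "product_one_free f A"
    and "B \<subseteq> A" "C \<subseteq> A" "B \<inter> C = {}"
  shows "card (finprod G f ` Pow B) + card C \<le> card (finprod G f ` Pow (B \<union> C))"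
proof -
  have "finite C" using assms finite_subset by blast
  then show ?thesis using assms(5,6)
  proof (induction C rule: finite_induct)
    case empty
    then show ?case by simp
  next
    case (insert c C)
    let ?D = "B \<union> C"
    have D: "insert c ?D \<subseteq> A" "c \<notin> ?D" using insert assms by auto
    have fin: "finite (insert c ?D)" by (rule finite_subset[OF D(1) assms(1)])
    have "finprod G f (insert c ?D) \<notin> finprod G f ` Pow ?D"
    proof
      assume "finprod G f (insert c ?D) \<in> finprod G f ` Pow ?D"
      then obtain J where J: "J \<subseteq> ?D" "finprod G f J = finprod G f (insert c ?D)" by auto
      then have "J \<subset> insert c ?D" using D by auto
      from finprod_psubset_neq[OF assms(1-3) this D(1)] J show False by simp
    qed
    then have "Suc (card (finprod G f ` Pow ?D))
        = card (insert (finprod G f (insert c ?D)) (finprod G f ` Pow ?D))"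
      by (rule card_insert_disjoint[symmetric, rotated]) (use fin in simp)
    also have "\<dots> \<le> card (finprod G f ` Pow (insert c ?D))"
      by (rule card_mono) (use fin in auto)
    finally have "Suc (card (finprod G f ` Pow ?D)) \<le> card (finprod G f ` Pow (B \<union> insert c C))"
      by simp
    moreover have "card (finprod G f ` Pow B) + card C \<le> card (finprod G f ` Pow ?D)"
      using insert by auto
    ultimately show ?case using insert(1,2) by simp
  qed
qed

lemma card_subproducts_le_order:
  assumes "finite (carrier G)" "f \<in> A \<rightarrow> carrier G"
  shows "card (finprod G f ` Pow A) \<le> order G"
  unfolding order_def using assms by (intro card_mono) (auto intro!: finprod_closed)

text \<open>Growing \<open>A\<close> from the empty set, whose only subproduct is
  \<open>\<one>\<close>, produces at least \<open>card A + 1\<close> values.\<close>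

lemma card_less_order_if_product_one_free:
  assumes "finite (carrier G)" "finite A" "f \<in> A \<rightarrow> carrier G" "product_one_free f A"
  shows "card A < order G"
  using card_subproducts_add[of A f "{}" A] card_subproducts_le_order[of f A] assms by simp

lemma product_one_free_max_const:
  assumes "finite (carrier G)" "finite A" "f \<in> A \<rightarrow> carrier G" "product_one_free f A"
    and "card A + 1 = order G" "i \<in> A" "j \<in> A"
  shows "f i = f j"
proof (rule ccontr)
  assume neq: "f i \<noteq> f j"
  then have ij: "i \<noteq> j" by auto
  have c: "f i \<in> carrier G" "f j \<in> carrier G" using assms by auto
  note ne = finprod_psubset_neq[OF assms(2-4)]
  have "finprod G f {} \<noteq> finprod G f {i}" "finprod G f {} \<noteq> finprod G f {j}"
    "finprod G f {} \<noteq> finprod G f {i,j}" "finprod G f {i} \<noteq> finprod G f {i,j}"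
    "finprod G f {j} \<noteq> finprod G f {i,j}"
    by (rule ne; use assms ij in auto)+
  \<comment> \<open>The singletons are not nested, so cancellation does not apply to this pair; here
    the two terms themselves differ.\<close>
  moreover have "finprod G f {i} \<noteq> finprod G f {j}"
    using neq c by simp
  ultimately have "card {finprod G f {}, finprod G f {i}, finprod G f {j}, finprod G f {i,j}} = 4"
    by (simp only: card_insert_if finite.intros insert_iff empty_iff simp_thms if_False card.empty)
  moreover have "card {finprod G f {}, finprod G f {i}, finprod G f {j}, finprod G f {i,j}}
      \<le> card (finprod G f ` Pow {i,j})"
    by (rule card_mono, simp, intro subsetI, elim insertE emptyE; intro image_eqI[rotated]) auto
  moreover have "card (finprod G f ` Pow {i,j}) + card (A - {i,j})
      \<le> card (finprod G f ` Pow ({i,j} \<union> (A - {i,j})))"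
    by (rule card_subproducts_add) (use assms in auto)
  moreover have "{i,j} \<union> (A - {i,j}) = A" using assms by auto
  moreover have "card A = card (A - {i,j}) + 2"
    using card_mono[of A "{i,j}"] assms ij by (simp add: card_Diff_subset)
  \<comment> \<open>There are at least 4 + (card A - 2) = \<open>order G + 1\<close> distinct
    products.\<close>
  ultimately show False
    using card_subproducts_le_order[of f A] assms by simp
qed

section \<open>Splitting off a term and inverting terms\<close>

lemma num_prods_insert:
  assumes "finite A" "f \<in> insert i A \<rightarrow> carrier G" "i \<notin> A"
  shows "num_prods f (insert i A) \<one> = num_prods f A \<one> + num_prods f A (inv (f i))"
proof -
  let ?X = "{I. I \<subseteq> A \<and> finprod G f I = \<one>}" and ?Y = "{I. I \<subseteq> A \<and> finprod G f I = inv (f i)}"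
  have iff: "finprod G f (insert i I) = \<one> \<longleftrightarrow> finprod G f I = inv (f i)" if "I \<subseteq> A" for I
  proof -
    have "finprod G f (insert i I) = f i \<otimes> finprod G f I"
      by (rule finprod_insert) (use that assms in \<open>auto intro: finite_subset\<close>)
    moreover have "finprod G f I \<in> carrier G" "f i \<in> carrier G"
      using that assms by (auto intro!: finprod_closed)
    ultimately show ?thesis
      by (metis inv_equality inv_inv m_comm r_inv)
  qed
  have "{I. I \<subseteq> insert i A \<and> finprod G f I = \<one>} = ?X \<union> insert i ` ?Y"
  proof (intro equalityI subsetI)
    fix I assume I: "I \<in> {I. I \<subseteq> insert i A \<and> finprod G f I = \<one>}"
    show "I \<in> ?X \<union> insert i ` ?Y"
    proof (cases "i \<in> I")
      case True
      then have I': "I = insert i (I - {i})" "I - {i} \<subseteq> A" using I by auto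
      have "finprod G f I = \<one>" using I by simp
      then have "I - {i} \<in> ?Y" using I' iff[of "I - {i}"] by simp
      then show ?thesis using I'(1) by (intro UnI2 image_eqI)
    qed (use I in auto)
  qed (use iff in auto)
  moreover have "card (?X \<union> insert i ` ?Y) = card ?X + card (insert i ` ?Y)"
    by (rule card_Un_disjoint) (use assms in auto)
  moreover have "card (insert i ` ?Y) = card ?Y"
    by (rule card_image) (use assms in \<open>auto simp: inj_on_def\<close>)
  ultimately show ?thesis unfolding num_prods_def by simp
qed

text \<open>Since \<open>T\<close> has product one, the inverse of \<open>f i\<close> is the product
  over \<open>T - {i}\<close>. The second summand thus counts a value attained within
  \<open>A - {i}\<close>, as the inversion lemma requires.\<close>

lemma num_prods_one_split:
  assumes "finite A" "f \<in> A \<rightarrow> carrier G" "T \<subseteq> A" "finprod G f T = \<one>" "i \<in> T"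
  shows "num_prods f A \<one> = num_prods f (A - {i}) \<one> + num_prods f (A - {i}) (finprod G f (T - {i}))"
proof -
  have A: "insert i (A - {i}) = A" using assms by auto
  have "finprod G f (insert i (T - {i})) = f i \<otimes> finprod G f (T - {i})"
    by (rule finprod_insert) (use assms in \<open>auto intro: finite_subset\<close>)
  moreover have "finprod G f (T - {i}) \<in> carrier G" "f i \<in> carrier G"
    using assms by (auto intro!: finprod_closed)
  ultimately have "finprod G f (T - {i}) = inv (f i)"
    using assms by (metis insert_Diff inv_equality m_comm)
  then show ?thesis
    using num_prods_insert[of "A - {i}" f i] assms(1,2) unfolding A by simp
qed

lemma num_prods_invert_subset:
  assumes "finite A" "f \<in> A \<rightarrow> carrier G" "T \<subseteq> A"
  shows "num_prods f A (finprod G f T) = num_prods (\<lambda>i. if i \<in> T then inv (f i) else f i) A \<one>"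
proof -
  let ?f = "\<lambda>i. if i \<in> T then inv (f i) else f i"
  let ?d = "\<lambda>I. (I - T) \<union> (T - I)"
  have fc: "f i \<in> carrier G" if "i \<in> A" for i using that assms(2) by auto
  have clos: "finprod G f I \<in> carrier G" if "I \<subseteq> A" for I
    using that assms by (auto intro!: finprod_closed)
  \<comment> \<open>The inverted terms over \<open>T - I\<close> cancel against \<open>T\<close>,
    leaving the product over \<open>I \<inter> T\<close>, which completes \<open>I - T\<close> to
    \<open>I\<close>.\<close>
  have d: "finprod G ?f (?d I) \<otimes> finprod G f T = finprod G f I" if I: "I \<subseteq> A" for I
  proof -
    have fin: "finite I" "finite T" using I assms finite_subset by blast+
    have "finprod G ?f (?d I) = finprod G ?f (I - T) \<otimes> finprod G ?f (T - I)"
      by (rule finprod_Un_disjoint) (use fin I assms(3) fc in auto)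
    also have "finprod G ?f (I - T) = finprod G f (I - T)"
      by (rule finprod_cong') (use I assms(3) fc in auto)
    also have "finprod G ?f (T - I) = finprod G (\<lambda>i. inv (f i)) (T - I)"
      by (rule finprod_cong') (use I assms(3) fc in auto)
    finally have 1: "finprod G ?f (?d I) = finprod G f (I - T) \<otimes> finprod G (\<lambda>i. inv (f i)) (T - I)" .
    have 2: "finprod G (\<lambda>i. inv (f i)) (T - I) \<otimes> finprod G f (T - I) = \<one>"
    proof -
      have "finprod G (\<lambda>i. inv (f i)) (T - I) \<otimes> finprod G f (T - I)
          = finprod G (\<lambda>i. inv (f i) \<otimes> f i) (T - I)"
        by (rule finprod_multf[symmetric]) (use assms(3) fc in auto)
      also have "\<dots> = \<one>"
        by (rule finprod_one_eqI) (use assms(3) fc in auto)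
      finally show ?thesis .
    qed
    have 3: "finprod G f T = finprod G f (T - I) \<otimes> finprod G f (I \<inter> T)"
      using finprod_subset_split[of T f "T - I"] fin assms by (auto simp: Diff_Diff_Int Int_commute)
    have 4: "finprod G f I = finprod G f (I - T) \<otimes> finprod G f (I \<inter> T)"
      using finprod_subset_split[of I f "I - T"] fin I assms by (auto simp: Diff_Diff_Int)
    have c: "finprod G f (I - T) \<in> carrier G" "finprod G f (T - I) \<in> carrier G"
      "finprod G f (I \<inter> T) \<in> carrier G" "finprod G (\<lambda>i. inv (f i)) (T - I) \<in> carrier G"
      using I assms(3) fc by (auto intro!: finprod_closed)
    then show ?thesis unfolding 1 3 4
      by (metis 2 m_assoc m_closed l_one)
  qed
  have iff: "finprod G ?f (?d I) = \<one> \<longleftrightarrow> finprod G f I = finprod G f T" if I: "I \<subseteq> A" for I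
  proof -
    have "finprod G ?f (?d I) \<in> carrier G"
      by (rule finprod_closed) (use I assms(3) fc in auto)
    then show ?thesis using d[OF I] clos[OF assms(3)] by (metis l_one r_cancel_one)
  qed
  have dd: "?d (?d I) = I" for I by auto
  have sub: "?d I \<subseteq> A" if "I \<subseteq> A" for I using that assms by auto
  have "bij_betw ?d {I. I \<subseteq> A \<and> finprod G f I = finprod G f T} {I. I \<subseteq> A \<and> finprod G ?f I = \<one>}"
  \<comment> \<open>Symmetric difference with \<open>T\<close> is an involution, hence its own
    inverse.\<close>
  proof (rule bij_betw_byWitness[where f' = ?d])
    show "?d ` {I. I \<subseteq> A \<and> finprod G f I = finprod G f T} \<subseteq> {I. I \<subseteq> A \<and> finprod G ?f I = \<one>}"
    proof (rule image_subsetI)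
      fix I assume "I \<in> {I. I \<subseteq> A \<and> finprod G f I = finprod G f T}"
      then show "?d I \<in> {I. I \<subseteq> A \<and> finprod G ?f I = \<one>}"
        using iff[of I] sub[of I] by (simp only: mem_Collect_eq simp_thms)
    qed
    show "?d ` {I. I \<subseteq> A \<and> finprod G ?f I = \<one>} \<subseteq> {I. I \<subseteq> A \<and> finprod G f I = finprod G f T}"
    proof (rule image_subsetI)
      fix I assume "I \<in> {I. I \<subseteq> A \<and> finprod G ?f I = \<one>}"
      then show "?d I \<in> {I. I \<subseteq> A \<and> finprod G f I = finprod G f T}"
        using iff[of "?d I"] sub[of I] unfolding dd by (simp only: mem_Collect_eq simp_thms)
    qed
  qed (intro ballI dd)+
  then show ?thesis
    unfolding num_prods_def by (rule bij_betw_same_card)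
qed

section \<open>Olson's lower bound\<close>

text \<open>Multiplying Olson's bound by \<open>2^n\<close> avoids truncated exponents.\<close>

lemma num_prods_one_lower_bound:
  assumes "finite (carrier G)" "finite A" "f \<in> A \<rightarrow> carrier G"
  shows "2 ^ (card A + 1) \<le> num_prods f A \<one> * 2 ^ order G"
  using assms(2,3)
\<comment> \<open>The family \<open>f\<close> must vary, because the induction hypothesis is also
  applied to the sequence with inverted terms.\<close>
proof (induction "card A" arbitrary: A f)
  case 0
  have "0 < order G" using assms(1) order_gt_0_iff_finite by blast
  then have "(2::nat) ^ 1 \<le> 2 ^ order G" by (intro power_increasing) auto
  moreover have "1 \<le> num_prods f A \<one>" using num_prods_one_pos[OF 0(2)] by (simp add: Suc_le_eq)
  ultimately have "1 * (2::nat) ^ 1 \<le> num_prods f A \<one> * 2 ^ order G" by (intro mult_mono) auto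
  then show ?case using 0 by simp
next
  case (Suc m)
  show ?case
  proof (cases "product_one_free f A")
    case True
    then have "card A + 1 \<le> order G"
      using card_less_order_if_product_one_free[of A f] assms(1) Suc by simp
    then have "(2::nat) ^ (card A + 1) \<le> 2 ^ order G" by (intro power_increasing) auto
    moreover have "1 \<le> num_prods f A \<one>" using num_prods_one_pos[OF Suc(3)] by (simp add: Suc_le_eq)
    ultimately have "1 * (2::nat) ^ (card A + 1) \<le> num_prods f A \<one> * 2 ^ order G"
      by (intro mult_mono) auto
    then show ?thesis by simp
  next
    case False
    then obtain T i where T: "T \<subseteq> A" "finprod G f T = \<one>" "i \<in> T"
      unfolding product_one_free_def by auto
    let ?B = "A - {i}"
    have B: "finite ?B" "m = card ?B" "card A = Suc (card ?B)"
      using card_Suc_Diff1[of A i] T(1,3) Suc(2,3) by auto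
    have "num_prods f ?B (finprod G f (T - {i}))
        = num_prods (\<lambda>j. if j \<in> T - {i} then inv (f j) else f j) ?B \<one>"
      by (rule num_prods_invert_subset) (use T Suc in auto)
    moreover have "2 ^ (card ?B + 1)
        \<le> num_prods (\<lambda>j. if j \<in> T - {i} then inv (f j) else f j) ?B \<one> * 2 ^ order G"
      by (rule Suc(1)) (use B(1,2) Suc(4) in \<open>auto simp: Pi_iff\<close>)
    moreover have "2 ^ (card ?B + 1) \<le> num_prods f ?B \<one> * 2 ^ order G"
      by (rule Suc(1)) (use B(1,2) Suc(4) in auto)
    ultimately show ?thesis
      using B(3) num_prods_one_split[OF Suc(3,4) T] by (simp add: add_mult_distrib)
  qed
qed

text \<open>Inversion carries the bound for \<open>\<one>\<close> over to every value attained by a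
  subsequence.\<close>

lemma num_prods_lower_bound:
  assumes "finite (carrier G)" "finite A" "f \<in> A \<rightarrow> carrier G" "T \<subseteq> A"
  shows "2 ^ (card A + 1) \<le> num_prods f A (finprod G f T) * 2 ^ order G"
  unfolding num_prods_invert_subset[OF assms(2-4)]
  by (rule num_prods_one_lower_bound) (use assms in \<open>auto simp: Pi_iff\<close>)

section \<open>The case of equality\<close>

text \<open>If \<open>ord a\<close> were at most \<open>card A\<close>, then \<open>ord a\<close>
  copies of \<open>a\<close> would form a nonempty subsequence with product one.\<close>

lemma generate_eq_carrier_if_product_one_free_const:
  assumes "finite (carrier G)" "finite A" "product_one_free f A" "card A + 1 = order G"
    and "a \<in> carrier G" "\<And>i. i \<in> A \<Longrightarrow> f i = a"
  shows "generate G {a} = carrier G"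
proof -
  have "ord a \<ge> order G"
  proof (rule ccontr)
    assume "\<not> ord a \<ge> order G"
    then have "ord a \<le> card A" using assms by simp
    then obtain T where T: "T \<subseteq> A" "card T = ord a"
      by (meson obtain_subset_with_card_n)
    have "finprod G f T = finprod G (\<lambda>_. a) T"
      by (rule finprod_cong') (use T assms in auto)
    also have "\<dots> = \<one>" using T(2) assms(5) by (simp add: finprod_const pow_ord_eq_1)
    finally have "T = {}" using assms T unfolding product_one_free_def by blast
    then show False using T ord_ge_1[OF assms(1,5)] by simp
  qed
  moreover have "ord a = card (generate G {a})"
    using assms generate_pow_card by blast
  moreover have "generate G {a} \<subseteq> carrier G"
    using assms generate_incl by simp
  ultimately show ?thesis
    using assms(1) unfolding order_def by (metis card_seteq)
qed

lemma num_prods_one_extremal: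
  assumes "finite (carrier G)" "order G \<ge> 3" "finite A" "f \<in> A \<rightarrow> carrier G - {\<one>}"
    and "num_prods f A \<one> * 2 ^ order G = 2 ^ (card A + 1)"
  shows "order G \<le> card A + 1 \<and> card A \<le> order G \<and>
    (\<exists>a \<in> carrier G. generate G {a} = carrier G \<and> (\<forall>i \<in> A. f i = a))"
  using assms(3-5)
proof (induction "card A" arbitrary: A rule: less_induct)
  case less
  note fin = less(2) and eq = less(4)
  have f: "f \<in> A \<rightarrow> carrier G" using less(3) by auto
  \<comment> \<open>The empty subsequence is always counted, so equality forces length at least
    \<open>order G - 1\<close>.\<close>
  have "1 * (2::nat) ^ order G \<le> num_prods f A \<one> * 2 ^ order G"
    using num_prods_one_pos[OF fin] by (intro mult_right_mono) (auto simp: Suc_le_eq)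
  then have "(2::nat) ^ order G \<le> 2 ^ (card A + 1)" using eq by simp
  then have le: "order G \<le> card A + 1" by (subst (asm) power_increasing_iff) simp_all
  show ?case
  proof (cases "order G = card A + 1")
    case True
    then have free: "product_one_free f A"
      using eq product_one_free_if_num_prods_eq_1 by simp
    have "card A \<noteq> 0" using True assms(2) by linarith
    then obtain i where i: "i \<in> A" by (metis card.empty ex_in_conv)
    have const: "f j = f i" if "j \<in> A" for j
      by (rule product_one_free_max_const[OF assms(1) fin f free True[symmetric] that i])
    have "f i \<in> carrier G" using f i by auto
    moreover from this have "generate G {f i} = carrier G"
      using const by (rule generate_eq_carrier_if_product_one_free_const[OF assms(1) fin free True[symmetric]])
    ultimately show ?thesis using True const by auto
  next
    case False
    then have ge: "order G \<le> card A" using le by simp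
    then obtain T i where T: "T \<subseteq> A" "finprod G f T = \<one>" "i \<in> T"
      using card_less_order_if_product_one_free[OF assms(1) fin f]
      unfolding product_one_free_def by (metis ex_in_conv leD)
    have finT: "finite T" using T fin finite_subset by blast
    have "f i \<in> carrier G" "f i \<noteq> \<one>" using T less(3) by auto
    \<comment> \<open>As \<open>\<one>\<close> is not a term, \<open>T\<close> has a second index,
      which gives two choices for the removed term.\<close>
    then have "T \<noteq> {i}" using T by auto
    then obtain j where j: "j \<in> T" "j \<noteq> i" using T by auto
    have step: "card (A - {k}) \<le> order G \<and>
        (\<exists>a \<in> carrier G. generate G {a} = carrier G \<and> (\<forall>l \<in> A - {k}. f l = a))" if k: "k \<in> T" for k
    proof -
      let ?B = "A - {k}"
      have B: "card A = Suc (card ?B)" using card_Suc_Diff1[of A k] fin T(1) k by auto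
      have "2 ^ (card ?B + 1) \<le> num_prods f ?B (finprod G f (T - {k})) * 2 ^ order G"
        by (rule num_prods_lower_bound) (use assms T f fin in auto)
      moreover have "2 ^ (card ?B + 1) \<le> num_prods f ?B \<one> * 2 ^ order G"
        by (rule num_prods_one_lower_bound) (use assms f fin in auto)
      moreover have "num_prods f ?B \<one> * 2 ^ order G
          + num_prods f ?B (finprod G f (T - {k})) * 2 ^ order G = 2 * 2 ^ (card ?B + 1)"
        using eq B num_prods_one_split[OF fin f T(1,2) k] by (simp add: add_mult_distrib)
      \<comment> \<open>Both summands reach the lower bound and their sum is exactly twice that
        bound, so each equals it.\<close>
      ultimately have "num_prods f ?B \<one> * 2 ^ order G = 2 ^ (card ?B + 1)"
        by linarith
      then show ?thesis
        using less(1)[of ?B] B fin less(3) by auto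
    qed
    obtain a where a: "a \<in> carrier G" "generate G {a} = carrier G" "\<forall>l \<in> A - {i}. f l = a"
      using step[OF T(3)] by auto
    obtain b where b: "\<forall>l \<in> A - {j}. f l = b"
      using step[OF j(1)] by auto
    \<comment> \<open>Because \<open>order G\<close> is at least 3, some third index survives both
      removals and identifies the two constants.\<close>
    have "card {i, j} < card A" using ge assms(2) j by simp
    then obtain k where k: "k \<in> A" "k \<noteq> i" "k \<noteq> j"
      by (metis card_mono finite.emptyI finite_insert insertCI leD subsetI)
    then have "a = b" using a b by auto
    then have const: "\<forall>l \<in> A. f l = a" using a b j by (metis Diff_iff singletonD)
    have "card A \<le> order G"
    proof (rule ccontr)
      assume "\<not> card A \<le> order G"
      \<comment> \<open>The sequence without \<open>i\<close> has length at most
        \<open>order G\<close>, so only this length remains to be excluded.\<close>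
      then have cA: "card A = order G + 1"
        using step[OF T(3)] T fin by (auto simp: card_Diff_singleton_if split: if_splits)
      have one: "finprod G f (A - {l}) = \<one>" if "l \<in> A" for l
      proof -
        have "finprod G f (A - {l}) = finprod G (\<lambda>_. a) (A - {l})"
          by (rule finprod_cong') (use const a in auto)
        also have "\<dots> = a [^] order G"
          using a(1) that cA by (simp add: finprod_const)
        finally show ?thesis using pow_order_eq_1[OF a(1)] by simp
      qed
      have ne: "A - {l} \<noteq> {}" for l
      proof
        assume "A - {l} = {}"
        then have "card A \<le> card {l}" by (intro card_mono) auto
        then show False using cA assms(2) by simp
      qed
      \<comment> \<open>The empty set and the \<open>order G + 1\<close> complements of single
        indices all have product one. This makes at least 5 subsequences, whereas equality allows
        exactly 4.\<close>
      have "card (insert {} ((\<lambda>l. A - {l}) ` A)) \<le> num_prods f A \<one>"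
        unfolding num_prods_def by (rule card_mono) (use one fin in auto)
      moreover have "card ((\<lambda>l. A - {l}) ` A) = card A"
        by (rule card_image) (auto simp: inj_on_def)
      moreover have "{} \<notin> (\<lambda>l. A - {l}) ` A" using ne by force
      ultimately have "order G + 2 \<le> num_prods f A \<one>" using fin cA by simp
      moreover have "num_prods f A \<one> = 4"
        using eq cA by simp
      ultimately show False using assms(2) by simp
    qed
    then show ?thesis using a const le by blast
  qed
qed

end

section \<open>Transfer to multisets\<close>

theorem theorem3p4:
  fixes G :: "('a, 'b) monoid_scheme" and n :: nat and S :: "'a multiset"
  assumes "group G" and "cyclic_group G" and "order G = n" and "n \<ge> 3"
    and "set_mset S \<subseteq> carrier G" and "\<one>\<^bsub>G\<^esub> \<notin># S"
    and "real (N0 G S) = 2 powi (int (size S) - int n + 1)"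
  shows "n - 1 \<le> size S \<and> size S \<le> n \<and>
    (\<exists>a \<in> carrier G. generate G {a} = carrier G \<and> S = replicate_mset (size S) a)"
proof -
  interpret comm_group G
    using assms(1,2) by (simp add: group.cyclic_imp_abelian_group)
  have fin: "finite (carrier G)"
    using assms(3,4) order_gt_0_iff_finite by force
  obtain xs where xs: "mset xs = S" using ex_mset by blast
  then have len: "size S = length xs" by auto
  have set: "set xs \<subseteq> carrier G" "\<one>\<^bsub>G\<^esub> \<notin> set xs" using assms(5,6) xs by auto
  have N: "N0 G S = num_prods (\<lambda>i. xs ! i) {..<length xs} \<one>\<^bsub>G\<^esub>"
    using N0_mset[OF set(1)] xs unfolding num_prods_def by simp
  \<comment> \<open>The integer exponent may be negative a priori; the factor \<open>2 ^ n\<close>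
    turns the hypothesis into an equation between natural numbers.\<close>
  have "real (N0 G S) * 2 ^ n = 2 powi (int (size S) - int n + 1) * 2 powi (int n)"
    using assms(7) by simp
  also have "\<dots> = 2 powi (int (size S + 1))"
    by (subst power_int_add[symmetric]) (auto simp: add.commute)
  also have "\<dots> = 2 ^ (size S + 1)" by (simp only: power_int_of_nat)
  finally have "real (N0 G S * 2 ^ n) = real (2 ^ (size S + 1))" by simp
  then have eq: "N0 G S * 2 ^ n = 2 ^ (size S + 1)" by (simp only: of_nat_eq_iff)
  have "order G \<le> card {..<length xs} + 1 \<and> card {..<length xs} \<le> order G \<and>
    (\<exists>a \<in> carrier G. generate G {a} = carrier G \<and> (\<forall>i \<in> {..<length xs}. xs ! i = a))"
  proof (rule num_prods_one_extremal)
    show "(\<lambda>i. xs ! i) \<in> {..<length xs} \<rightarrow> carrier G - {\<one>\<^bsub>G\<^esub>}"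
      using set nth_mem by (fastforce simp: Pi_def)
  qed (use fin assms(3,4) eq N len in simp_all)
  then obtain a where a: "n \<le> size S + 1" "size S \<le> n" "a \<in> carrier G" "generate G {a} = carrier G"
    "\<forall>i < length xs. xs ! i = a"
    using assms(3) len by auto
  have "set_mset S \<subseteq> {a}" using a(5) xs by (auto simp: in_set_conv_nth)
  then have "S = replicate_mset (size S) a" by (rule set_mset_subset_singletonD)
  then show ?thesis using a by auto
qed

end
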